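(* Let $n\ge1$ and let $U=\begin{bmatrix}s_0&B\\ C&D\end{bmatrix}$ be a unitary $(n+1)\times(n+1)$ matrix, where $s_0\in\mathbb{C}$, $B\in\mathfrak{M}_{1\times n}$, $C\in\mathfrak{M}_{n\times1}$, $D\in\mathfrak{M}_{n\times n}$. Then there exists a unitary $n\times n$ matrix $V_0$ such that $$\begin{bmatrix}1&0_{1\times n}\\ 0_{n\times1}&V_0^*\end{bmatrix}U\begin{bmatrix}1&0_{1\times n}\\ 0_{n\times1}&V_0\end{bmatrix}=\begin{bmatrix}s_0&B_0\\ C_0&D_0\end{bmatrix},$$ where the block entry $B_0\in\mathfrak{M}_{1\times n}$ is $$B_0=\begin{bmatrix}(1-|s_0|^2)^{1/2}&0_{1\times(n-1)}\end{bmatrix}.$$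
   Context: $\mathfrak{M}_{p\times q}$ is the set of complex $p\times q$ matrices; $0_{p\times q}$ is the zero matrix of that size. *)

theory Defs
  imports Complex_Main "Jordan_Normal_Form.Schur_Decomposition"
begin

(* On complex matrices mat_adjoint is the conjugate transpose. *)
definition unitary_mat :: "nat \<Rightarrow> complex mat \<Rightarrow> bool" where
  "unitary_mat n U \<longleftrightarrow>
     U \<in> carrier_mat n n \<and> mat_adjoint U * U = 1\<^sub>m n \<and> U * mat_adjoint U = 1\<^sub>m n"

definition scalar_block :: "complex \<Rightarrow> complex mat" where
  "scalar_block c = mat 1 1 (\<lambda>_. c)"

end

theory Submission
  imports Defs
begin

text \<open>
  Since \<open>U\<close> is unitary, its first row is a unit vector, so the row \<open>B\<close> has Euclidean norm
  \<open>(1 - |s\<^sub>0|\<^sup>2)\<^sup>1\<^sup>/\<^sup>2\<close>. Every vector \<open>v\<close> of length \<open>n \<ge> 1\<close> is its norm times the first column of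
  some unitary matrix \<open>V\<close> (lemma \<open>unitary_mat_with_first_col\<close>): for \<open>v \<noteq> 0\<close>, complete
  \<open>v\<close> to a basis, apply Gram--Schmidt, and normalize. Apply this to \<open>v = B\<^sup>*\<close>. Since the columns of
  \<open>V\<close> are orthonormal, \<open>B V = v\<^sup>* V\<close> is the norm of \<open>B\<close> times the first unit row, and \<open>B V\<close> is
  precisely the upper right block of the conjugated matrix.
\<close>

lemma mat_adjoint_carrier:
  "A \<in> carrier_mat m n \<Longrightarrow> mat_adjoint A \<in> carrier_mat n m"
  by (auto simp: mat_adjoint_def mat_of_rows_def)

lemma index_mat_adjoint:
  assumes "A \<in> carrier_mat m n" "i < n" "j < m"
  shows "mat_adjoint A $$ (i, j) = conjugate (A $$ (j, i))"
  using assms by (auto simp: mat_adjoint_def mat_of_rows_def)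

lemma index_mat_adjoint_mult:
  assumes A: "A \<in> carrier_mat m n" and i: "i < n" and j: "j < n"
  shows "(mat_adjoint A * A) $$ (i, j) = conjugate (col A i) \<bullet> col A j"
  using assms by (auto simp: mat_adjoint_def)

lemma index_mult_mat_adjoint:
  assumes A: "A \<in> carrier_mat m n" and i: "i < m" and j: "j < m"
  shows "(A * mat_adjoint A) $$ (i, j) = row A i \<bullet>c row A j"
proof -
  have "col (mat_adjoint A) j = conjugate (row A j)"
    using A j mat_adjoint_carrier[OF A]
    by (intro eq_vecI) (auto simp: index_mat_adjoint[OF A])
  then show ?thesis
    using A i j mat_adjoint_carrier[OF A] by simp
qed

lemma unitary_matI_cols:
  assumes V: "V \<in> carrier_mat n n"
    and orth: "\<And>i j. i < n \<Longrightarrow> j < n \<Longrightarrow> conjugate (col V i) \<bullet> col V j = (if i = j then 1 else 0)"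
  shows "unitary_mat n V"
proof -
  note V' = mat_adjoint_carrier[OF V]
  have "mat_adjoint V * V = 1\<^sub>m n"
    using V V' by (intro eq_matI) (auto simp: index_mat_adjoint_mult[OF V] orth simp del: index_mult_mat(1))
  with V V' mat_mult_left_right_inverse[OF V' V] show ?thesis
    by (simp add: unitary_mat_def)
qed

lemma cscalar_prod_self_complex:
  fixes v :: "complex vec"
  shows "v \<bullet>c v = complex_of_real (Re (v \<bullet>c v))" "Re (v \<bullet>c v) \<ge> 0"
  using conjugate_square_ge_0_vec[of v]
  by (auto simp: less_eq_complex_def complex_eq_iff)

lemma unitary_mat_with_first_col:
  fixes v :: "complex vec"
  assumes n: "n \<ge> 1" and v: "v \<in> carrier_vec n"
  shows "\<exists>V. unitary_mat n V \<and> v = complex_of_real (sqrt (Re (v \<bullet>c v))) \<cdot>\<^sub>v col V 0"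
proof (cases "v = 0\<^sub>v n")
  case True
  \<comment> \<open>The norm is zero, so any unitary matrix will do.\<close>
  have "unitary_mat n (1\<^sub>m n)"
    by (rule unitary_matI_cols) auto
  with True n show ?thesis
    by (intro exI[of _ "1\<^sub>m n"]) (auto simp: scalar_prod_def)
next
  case False
  interpret cof_vec_space n "TYPE(complex)" .
  define b where "b = basis_completion v"
  define ws where "ws = gram_schmidt n b"
  note bc = basis_completion[OF v False, folded b_def]
  from bc(6,7) n obtain vs where bv: "b = v # vs" by (cases b) auto
  note gs = gram_schmidt_result[OF bc(2,4,5) ws_def]
  have len: "length ws = n" using gs(4) bc(6) by simp
  have hd_ws: "hd ws = v" unfolding ws_def bv by (rule gram_schmidt_hd[OF v])
  have ws0: "ws ! 0 = v"
    using hd_conv_nth[of ws] hd_ws len n by (cases ws) auto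
  have wsc: "ws ! i \<in> carrier_vec n" if "i < n" for i
    using gs(3) len that by auto
  \<comment> \<open>The norm of \<open>w\<close>, embedded in the complex numbers.\<close>
  define r where "r w = complex_of_real (sqrt (Re (w \<bullet>c w)))" for w :: "complex vec"
  have r_sq: "r w * r w = w \<bullet>c w" for w
  proof -
    have "r w * r w = complex_of_real (Re (w \<bullet>c w))"
      unfolding r_def using cscalar_prod_self_complex(2)[of w]
      by (metis of_real_mult real_sqrt_mult_self abs_of_nonneg)
    then show ?thesis using cscalar_prod_self_complex(1)[of w] by simp
  qed
  have r_nz: "r (ws ! i) \<noteq> 0" if "i < n" for i
    using corthogonalD[OF gs(2), of i i] r_sq[of "ws ! i"] that len by auto
  define us where "us = map (\<lambda>w. (1 / r w) \<cdot>\<^sub>v w) ws"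
  define V where "V = mat_of_cols n us"
  have V: "V \<in> carrier_mat n n"
    by (simp add: V_def us_def mat_of_cols_def len)
  have colV: "col V i = (1 / r (ws ! i)) \<cdot>\<^sub>v ws ! i" if "i < n" for i
    using that wsc[OF that] len unfolding V_def us_def
    by (subst col_mat_of_cols) auto
  have "unitary_mat n V"
  proof (rule unitary_matI_cols[OF V])
    fix i j assume i: "i < n" and j: "j < n"
    have cr: "conjugate (r w) = r w" for w by (simp add: r_def)
    have "conjugate (ws ! i) \<bullet> ws ! j = ws ! j \<bullet>c ws ! i"
      by (rule conjugate_vec_sprod_comm[OF wsc wsc, symmetric]) fact+
    then have eq: "conjugate (col V i) \<bullet> col V j
        = (1 / r (ws ! i)) * (1 / r (ws ! j)) * (ws ! j \<bullet>c ws ! i)"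
      using wsc[OF i] wsc[OF j] cr[of "ws ! i"]
      by (simp add: colV i j conjugate_smult_vec)
    show "conjugate (col V i) \<bullet> col V j = (if i = j then 1 else 0)"
    proof (cases "i = j")
      case True
      with eq r_nz[OF i] show ?thesis by (simp add: r_sq[symmetric])
    next
      case False
      with eq corthogonalD[OF gs(2), of j i] i j len show ?thesis by simp
    qed
  qed
  moreover have "v = r v \<cdot>\<^sub>v col V 0"
    using n colV[of 0] r_nz[of 0] v by (simp add: ws0 smult_smult_assoc)
  ultimately show ?thesis unfolding r_def by blast
qed

text \<open>Multiplication by a unitary matrix on the right moves the whole norm of a row into its first entry.\<close>

lemma unitary_mat_compress_row:
  assumes n: "n \<ge> 1" and B: "B \<in> carrier_mat 1 n"
  shows "\<exists>V. unitary_mat n V \<and>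
    B * V = mat 1 n (\<lambda>(i, j). if j = 0 then complex_of_real (sqrt (Re (row B 0 \<bullet>c row B 0))) else 0)"
proof -
  \<comment> \<open>The adjoint of \<open>B\<close>, so that the entries of \<open>B * V\<close> are the inner products of \<open>v\<close> with the columns of \<open>V\<close>.\<close>
  define v where "v = conjugate (row B 0)"
  have row: "row B 0 \<in> carrier_vec n" and v: "v \<in> carrier_vec n"
    using B by (auto simp: v_def)
  define r where "r = complex_of_real (sqrt (Re (row B 0 \<bullet>c row B 0)))"
  have vv: "v \<bullet>c v = row B 0 \<bullet>c row B 0"
    using conjugate_vec_sprod_comm[OF row row] by (simp add: v_def)
  obtain V where U: "unitary_mat n V" and vV: "v = r \<cdot>\<^sub>v col V 0"
    using unitary_mat_with_first_col[OF n v] unfolding vv r_def by blast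
  from U have V: "V \<in> carrier_mat n n" and VV: "mat_adjoint V * V = 1\<^sub>m n"
    by (auto simp: unitary_mat_def)
  have "conjugate r = r" by (simp add: r_def)
  with arg_cong[OF vV, of conjugate] have rowB: "row B 0 = r \<cdot>\<^sub>v conjugate (col V 0)"
    by (simp add: v_def conjugate_smult_vec)
  have "B * V = mat 1 n (\<lambda>(i, j). if j = 0 then r else 0)"
  proof (rule eq_matI)
    fix i j assume "i < dim_row (mat 1 n (\<lambda>(i, j). if j = 0 then r else 0))"
      "j < dim_col (mat 1 n (\<lambda>(i, j). if j = 0 then r else 0))"
    then have ij: "i = 0" "j < n" by auto
    have "(B * V) $$ (0, j) = r * (conjugate (col V 0) \<bullet> col V j)"
      using B V ij by (simp add: rowB)
    also have "conjugate (col V 0) \<bullet> col V j = (mat_adjoint V * V) $$ (0, j)"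
      using index_mat_adjoint_mult[OF V] n ij by simp
    also have "\<dots> = (if j = 0 then 1 else 0)"
      using n ij by (simp add: VV)
    finally show "(B * V) $$ (i, j) = mat 1 n (\<lambda>(i, j). if j = 0 then r else 0) $$ (i, j)"
      using ij by simp
  qed (use B V in auto)
  with U show ?thesis unfolding r_def by blast
qed

lemma unitary_first_row_norm:
  assumes B: "B \<in> carrier_mat 1 n" and C: "C \<in> carrier_mat n 1" and D: "D \<in> carrier_mat n n"
    and U: "unitary_mat (n + 1) (four_block_mat (scalar_block s) B C D)"
  shows "Re (row B 0 \<bullet>c row B 0) = 1 - (cmod s)\<^sup>2"
proof -
  let ?U = "four_block_mat (scalar_block s) B C D"
  have S: "scalar_block s \<in> carrier_mat 1 1" by (simp add: scalar_block_def)
  from U have c: "?U \<in> carrier_mat (n + 1) (n + 1)" and UU: "?U * mat_adjoint ?U = 1\<^sub>m (n + 1)"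
    by (auto simp: unitary_mat_def)
  have "row ?U 0 = row (scalar_block s) 0 @\<^sub>v row B 0"
    using row_four_block_mat(1)[OF S B C D, of 0] by simp
  moreover have "conjugate (row (scalar_block s) 0 @\<^sub>v row B 0)
      = conjugate (row (scalar_block s) 0) @\<^sub>v conjugate (row B 0)"
    by (intro eq_vecI) (auto simp: scalar_block_def)
  ultimately have "row ?U 0 \<bullet>c row ?U 0
      = row (scalar_block s) 0 \<bullet>c row (scalar_block s) 0 + row B 0 \<bullet>c row B 0"
    using S B by (simp add: scalar_prod_append[of _ 1 _ n] row_def)
  moreover have "row ?U 0 \<bullet>c row ?U 0 = 1"
    using index_mult_mat_adjoint[OF c, of 0 0] UU by simp
  moreover have "row (scalar_block s) 0 \<bullet>c row (scalar_block s) 0 = s * cnj s"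
    by (simp add: scalar_block_def scalar_prod_def)
  ultimately have "row B 0 \<bullet>c row B 0 = complex_of_real (1 - (cmod s)\<^sup>2)"
    by (simp add: complex_norm_square[symmetric] algebra_simps)
  then show ?thesis by simp
qed

theorem lemma7p2:
  fixes n :: nat and s\<^sub>0 :: complex and U B C D :: "complex mat"
  assumes "n \<ge> 1"
    and "B \<in> carrier_mat 1 n" and "C \<in> carrier_mat n 1" and "D \<in> carrier_mat n n"
    and "U = four_block_mat (scalar_block s\<^sub>0) B C D"
    and "unitary_mat (n + 1) U"
  shows "\<exists>V\<^sub>0 B\<^sub>0 C\<^sub>0 D\<^sub>0. unitary_mat n V\<^sub>0
    \<and> B\<^sub>0 \<in> carrier_mat 1 n \<and> C\<^sub>0 \<in> carrier_mat n 1 \<and> D\<^sub>0 \<in> carrier_mat n n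
    \<and> four_block_mat (1\<^sub>m 1) (0\<^sub>m 1 n) (0\<^sub>m n 1) (mat_adjoint V\<^sub>0) * U
        * four_block_mat (1\<^sub>m 1) (0\<^sub>m 1 n) (0\<^sub>m n 1) V\<^sub>0
      = four_block_mat (scalar_block s\<^sub>0) B\<^sub>0 C\<^sub>0 D\<^sub>0
    \<and> B\<^sub>0 = mat 1 n (\<lambda>(i, j). if j = 0 then complex_of_real (sqrt (1 - (cmod s\<^sub>0)\<^sup>2)) else 0)"
proof -
  note B = assms(2) and C = assms(3) and D = assms(4)
  have S: "scalar_block s\<^sub>0 \<in> carrier_mat 1 1" by (simp add: scalar_block_def)
  obtain V where V: "unitary_mat n V" and
    BV: "B * V = mat 1 n (\<lambda>(i, j). if j = 0 then complex_of_real (sqrt (1 - (cmod s\<^sub>0)\<^sup>2)) else 0)"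
    using unitary_mat_compress_row[OF assms(1) B]
    unfolding unitary_first_row_norm[OF B C D assms(6)[unfolded assms(5)]] by blast
  from V have Vc: "V \<in> carrier_mat n n" by (simp add: unitary_mat_def)
  note Wc = mat_adjoint_carrier[OF Vc]
  let ?W = "mat_adjoint V"
  have WC: "?W * C \<in> carrier_mat n 1" and WD: "?W * D \<in> carrier_mat n n"
    using Wc C D by auto
  have "four_block_mat (1\<^sub>m 1) (0\<^sub>m 1 n) (0\<^sub>m n 1) ?W * U
      = four_block_mat (scalar_block s\<^sub>0) B (?W * C) (?W * D)"
    unfolding assms(5) using S B C D Wc WC WD
    by (subst mult_four_block_mat[of _ 1 1 _ n _ n _ _ 1 _ n]) auto
  also have "\<dots> * four_block_mat (1\<^sub>m 1) (0\<^sub>m 1 n) (0\<^sub>m n 1) V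
      = four_block_mat (scalar_block s\<^sub>0) (B * V) (?W * C) (?W * D * V)"
    using S B Vc WC WD right_mult_one_mat[OF WC] right_mult_zero_mat[OF WC] right_mult_zero_mat[OF WD]
    by (subst mult_four_block_mat[of _ 1 1 _ n _ n _ _ 1 _ n]) auto
  finally show ?thesis
    using V BV B Vc WC WD by (intro exI[of _ V] exI[of _ "B * V"] exI[of _ "?W * C"] exI[of _ "?W * D * V"]) auto
qed

end
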